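(* If $\Gamma \models \mathbb{M}:\tau$ and $\mathbb{M} \longrightarrow \mathbb{M}'$ then $\Gamma \models \mathbb{M}' :\tau$.
   Context: $\widehat{\lambda}^{\text{↯}}_{\oplus}$: resource calculus with sharing and failure, terms $M ::= x \mid \lambda x.(M[\widetilde{x}\leftarrow x]) \mid M\,B \mid M\langle\!\langle N/x\rangle\!\rangle \mid \mathtt{fail}^{\widetilde{x}} \mid M[\widetilde{x}\leftarrow x] \mid (M[\widetilde{x}\leftarrow x])\langle B/x\rangle$, bags, sums. Reduction: $\beta$ to $M[\widetilde{x}\leftarrow x]\langle B/x\rangle$; expansion of $M[x_1,\dots,x_k\leftarrow x]\langle B/x\rangle$ into $\sum_{B_i\in\mathrm{PER}(B)}M\langle\!\langle B_i(1)/x_1\rangle\!\rangle\cdots\langle\!\langle B_i(k)/x_k\rangle\!\rangle$ when $|B|=k\ge1$ and $M$ is not a failure; $M\langle\!\langle N/x\rangle\!\rangle\longrightarrow M\{\!|N/x|\!\}$ when $\mathrm{head}(M)=x$; $M[x_1,\dots,x_k\leftarrow x]\langle B/x\rangle\longrightarrow\sum_{\mathrm{PER}(B)}\mathtt{fail}^{\widetilde{y}}$ when $k\ne|B|$ ($\widetilde{y}$ the free variables of $M$ minus $x_1..x_k$ plus those of $B$); consumption: $\mathtt{fail}^{\widetilde{x}}B\longrightarrow\sum\mathtt{fail}^{\widetilde{x}\cup\mathrm{fv}(B)}$, $(\mathtt{fail}^{\widetilde{x}\cup\widetilde{y}}[\widetilde{x}\leftarrow x])\langle B/x\rangle\longrightarrow\sum\mathtt{fail}^{\widetilde{y}\cup\mathrm{fv}(B)}$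 (when $|B|+|\widetilde{x}|\ne0$), $\mathtt{fail}^{\widetilde{y}\cup x}\langle\!\langle N/x\rangle\!\rangle\longrightarrow\mathtt{fail}^{\widetilde{y}\cup\mathrm{fv}(N)}$; closure under term contexts ($[\cdot]B$, $[\cdot]\langle\!\langle N/x\rangle\!\rangle$, $[\cdot][\widetilde{x}\leftarrow x]$, $[\cdot][\leftarrow x]\langle\mathtt{1}/x\rangle$) and sum contexts. $\models$ is well-formedness: built on the intersection type system with sharing, allowing mismatches of bag sizes in application and explicit substitution, and typing $\mathtt{fail}^{\widetilde{x}}$ with any type when $\mathrm{dom}(\Gamma)=\widetilde{x}$. *)

theory Defs
  imports
    "HOL-Library.Multiset"
    "HOL-Library.FSet"
    "HOL-Library.Infinite_Typeclass"
    "HOL-Combinatorics.Permutations"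
begin

section \<open>Terms, bags and expressions\<close>

text \<open>
  Bags are finite multisets of terms (concatenation is \<open>+\<close>, the empty bag is \<open>{#}\<close>).
  \<open>Lam M xs x\<close> is \<open>\<lambda>x.(M[xs \<leftarrow> x])\<close>, \<open>LSub M N x\<close> is the explicit linear
  substitution \<open>M\<llangle>N/x\<rrangle>\<close>, \<open>Share M xs x\<close> is \<open>M[xs \<leftarrow> x]\<close> and
  \<open>ESub M xs x B\<close> is \<open>(M[xs \<leftarrow> x])\<langle>B/x\<rangle>\<close>. The grammar admits abstraction and explicit
  substitution only on top of a sharing construct, hence the combined constructors.
\<close>

datatype 'v tm =
    Var 'v
  | Lam "'v tm" "'v list" 'v
  | App "'v tm" "'v tm multiset"
  | LSub "'v tm" "'v tm" 'v
  | Fail "'v fset"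
  | Share "'v tm" "'v list" 'v
  | ESub "'v tm" "'v list" 'v "'v tm multiset"

type_synonym 'v bag = "'v tm multiset"

text \<open>
  Sums are associative and commutative but not idempotent, so expressions are multisets of terms.
  A term \<open>M\<close> is the expression \<open>{#M#}\<close>; the empty multiset is not an expression of the
  calculus and is never typable.
\<close>

type_synonym 'v expr = "'v tm multiset"

primrec fv :: "'v tm \<Rightarrow> 'v set" where
  "fv (Var x) = {x}"
| "fv (Lam M xs x) = ((fv M - set xs) \<union> {x}) - {x}"
| "fv (App M B) = fv M \<union> \<Union> (set_mset (image_mset fv B))"
| "fv (LSub M N x) = (fv M - {x}) \<union> fv N"
| "fv (Fail X) = fset X"
| "fv (Share M xs x) = (fv M - set xs) \<union> {x}"
| "fv (ESub M xs x B) = (((fv M - set xs) \<union> {x}) - {x}) \<union> \<Union> (set_mset (image_mset fv B))"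

definition fv_bag :: "'v bag \<Rightarrow> 'v set" where
  "fv_bag B = (\<Union>N \<in> set_mset B. fv N)"

section \<open>Alpha-equivalence\<close>

text \<open>
  Terms are raw syntax with names; the calculus works up to renaming of bound names. The relation
  below is the least congruence that contains, for each binder, the swapping of two names that are
  not free in the scope of the binder. (The function \<open>map_tm (transpose a b)\<close> swaps
  \<open>a\<close> and \<open>b\<close> everywhere, at binding positions too.) Names bound by \<open>x\<close> in
  \<open>LSub M N x\<close> and \<open>ESub M xs x B\<close> have scope \<open>M\<close>, not \<open>N\<close> or \<open>B\<close>.
  The congruence rules for \<open>Lam\<close> and \<open>ESub\<close> go through \<open>Share\<close>, which yields the
  renaming of the inner shared names.
\<close>

inductive alpha :: "'v tm \<Rightarrow> 'v tm \<Rightarrow> bool" (infix \<open>\<approx>\<^sub>\<alpha>\<close> 50) where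
  alpha_refl: "M \<approx>\<^sub>\<alpha> M"
| alpha_sym: "M \<approx>\<^sub>\<alpha> M' \<Longrightarrow> M' \<approx>\<^sub>\<alpha> M"
| alpha_trans: "M \<approx>\<^sub>\<alpha> M' \<Longrightarrow> M' \<approx>\<^sub>\<alpha> M'' \<Longrightarrow> M \<approx>\<^sub>\<alpha> M''"
| alpha_Lam: "Share M xs x \<approx>\<^sub>\<alpha> Share M' xs' x \<Longrightarrow> Lam M xs x \<approx>\<^sub>\<alpha> Lam M' xs' x"
| alpha_App: "M \<approx>\<^sub>\<alpha> M' \<Longrightarrow> App M B \<approx>\<^sub>\<alpha> App M' B"
| alpha_App_bag: "N \<approx>\<^sub>\<alpha> N' \<Longrightarrow> App M (add_mset N B) \<approx>\<^sub>\<alpha> App M (add_mset N' B)"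
| alpha_LSub: "M \<approx>\<^sub>\<alpha> M' \<Longrightarrow> N \<approx>\<^sub>\<alpha> N' \<Longrightarrow> LSub M N x \<approx>\<^sub>\<alpha> LSub M' N' x"
| alpha_Share: "M \<approx>\<^sub>\<alpha> M' \<Longrightarrow> Share M xs x \<approx>\<^sub>\<alpha> Share M' xs x"
| alpha_ESub: "Share M xs x \<approx>\<^sub>\<alpha> Share M' xs' x \<Longrightarrow> ESub M xs x B \<approx>\<^sub>\<alpha> ESub M' xs' x B"
| alpha_ESub_bag:
    "N \<approx>\<^sub>\<alpha> N' \<Longrightarrow> ESub M xs x (add_mset N B) \<approx>\<^sub>\<alpha> ESub M xs x (add_mset N' B)"
| swap_Lam: "\<lbrakk> a \<notin> fv (Lam M xs x); b \<notin> fv (Lam M xs x) \<rbrakk> \<Longrightarrow>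
    Lam M xs x \<approx>\<^sub>\<alpha>
      Lam (map_tm (transpose a b) M) (map (transpose a b) xs) (transpose a b x)"
| swap_LSub: "\<lbrakk> a \<notin> fv M - {x}; b \<notin> fv M - {x} \<rbrakk> \<Longrightarrow>
    LSub M N x \<approx>\<^sub>\<alpha> LSub (map_tm (transpose a b) M) N (transpose a b x)"
| swap_Share: "\<lbrakk> a \<notin> fv M - set xs; b \<notin> fv M - set xs \<rbrakk> \<Longrightarrow>
    Share M xs x \<approx>\<^sub>\<alpha> Share (map_tm (transpose a b) M) (map (transpose a b) xs) x"
| swap_ESub: "\<lbrakk> a \<notin> fv (Share M xs x) - {x}; b \<notin> fv (Share M xs x) - {x} \<rbrakk> \<Longrightarrow>
    ESub M xs x B \<approx>\<^sub>\<alpha>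
      ESub (map_tm (transpose a b) M) (map (transpose a b) xs) (transpose a b x) B"

section \<open>Reduction\<close>

text \<open>\<open>share_head xs x (head M)\<close> is the head of \<open>M[xs \<leftarrow> x]\<close>.\<close>

definition share_head :: "'v list \<Rightarrow> 'v \<Rightarrow> 'v tm \<Rightarrow> 'v tm" where
  "share_head xs x h = (case h of Var y \<Rightarrow> if y \<in> set xs then Var x else Var y | _ \<Rightarrow> h)"

primrec head :: "'v tm \<Rightarrow> 'v tm" where
  "head (Var x) = Var x"
| "head (Lam M xs x) = Lam M xs x"
| "head (App M B) = head M"
| "head (LSub M N x) = head M"
| "head (Fail X) = Fail X"
| "head (Share M xs x) = share_head xs x (head M)"
| "head (ESub M xs x B) =
     (if length xs = size B then share_head xs x (head M) else Fail {||})"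

text \<open>
  \<open>lin_head_subst N x M M'\<close> states that the linear head substitution of \<open>N\<close> for
  \<open>x\<close> in \<open>M\<close> is defined without renaming and yields \<open>M'\<close>. It is a relation because
  the operation is partial (it is only defined for terms with head \<open>x\<close>), and the freshness
  conditions make it capture-avoiding; they can always be met by renaming.
\<close>

inductive lin_head_subst :: "'v tm \<Rightarrow> 'v \<Rightarrow> 'v tm \<Rightarrow> 'v tm \<Rightarrow> bool"
  for N :: "'v tm" and x :: 'v where
  lhs_Var: "lin_head_subst N x (Var x) N"
| lhs_App: "lin_head_subst N x M M' \<Longrightarrow> lin_head_subst N x (App M B) (App M' B)"
| lhs_LSub: "\<lbrakk> lin_head_subst N x M M'; x \<noteq> y; y \<notin> fv N \<rbrakk> \<Longrightarrow>
    lin_head_subst N x (LSub M L y) (LSub M' L y)"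
| lhs_Share: "\<lbrakk> lin_head_subst N x M M'; x \<noteq> y; x \<notin> set ys; set ys \<inter> fv N = {} \<rbrakk> \<Longrightarrow>
    lin_head_subst N x (Share M ys y) (Share M' ys y)"
| lhs_ESub: "\<lbrakk> lin_head_subst N x (Share M ys y) (Share M' ys y); x \<noteq> y; y \<notin> fv N \<rbrakk> \<Longrightarrow>
    lin_head_subst N x (ESub M ys y B) (ESub M' ys y B)"

text \<open>
  The permutations of the bag whose elements are listed by \<open>Ns\<close>, counted with multiplicity: there
  are \<open>k!\<close> of them for a bag of size \<open>k\<close>, also if the bag has repeated elements. The result
  does not depend on the order in which \<open>Ns\<close> lists the bag.
\<close>

definition PER :: "'v tm list \<Rightarrow> 'v tm list multiset" where
  "PER Ns = image_mset (\<lambda>p. permute_list p Ns) (mset_set {p. p permutes {..<length Ns}})"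

text \<open>\<open>lsubs M [N1,\<dots>,Nk] [x1,\<dots>,xk]\<close> is \<open>M\<llangle>N1/x1\<rrangle>\<cdots>\<llangle>Nk/xk\<rrangle>\<close>.\<close>

definition lsubs :: "'v tm \<Rightarrow> 'v tm list \<Rightarrow> 'v list \<Rightarrow> 'v tm" where
  "lsubs M Ns xs = foldl (\<lambda>T (N, x). LSub T N x) M (zip Ns xs)"

text \<open>The term contexts \<open>[\<cdot>] B\<close>, \<open>[\<cdot>]\<llangle>N/x\<rrangle>\<close>, \<open>[\<cdot>][xs \<leftarrow> x]\<close> and \<open>[\<cdot>][\<leftarrow> x]\<langle>1/x\<rangle>\<close>.\<close>

datatype 'v tctx =
    CApp "'v bag"
  | CLSub "'v tm" 'v
  | CShare "'v list" 'v
  | CESub 'v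

primrec fill :: "'v tctx \<Rightarrow> 'v tm \<Rightarrow> 'v tm" where
  "fill (CApp B) M = App M B"
| "fill (CLSub N x) M = LSub M N x"
| "fill (CShare xs x) M = Share M xs x"
| "fill (CESub x) M = ESub M [] x {#}"

text \<open>
  The freshness condition in \<open>ex_sub\<close> excludes capture of the free names of the bag. In
  \<open>cons2\<close> and \<open>cons3\<close> the union on the left-hand side is disjoint. Sum contexts need one
  rule only, since sums are commutative; \<open>red_alpha\<close> makes reduction a relation on terms up to
  renaming.
\<close>

inductive red :: "'v expr \<Rightarrow> 'v expr \<Rightarrow> bool" (infix \<open>\<longlongrightarrow>\<^sub>R\<close> 50) where
  beta: "{#App (Lam M xs x) B#} \<longlongrightarrow>\<^sub>R {#ESub M xs x B#}"
| ex_sub: "\<lbrakk> B = mset Ns; size B = length xs; length xs \<ge> 1; \<forall>Y. M \<noteq> Fail Y;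
      set xs \<inter> fv_bag B = {} \<rbrakk> \<Longrightarrow>
    {#ESub M xs x B#} \<longlongrightarrow>\<^sub>R {#lsubs M Bi xs. Bi \<in># PER Ns#}"
| lin_fetch: "\<lbrakk> head M = Var x; lin_head_subst N x M M' \<rbrakk> \<Longrightarrow> {#LSub M N x#} \<longlongrightarrow>\<^sub>R {#M'#}"
| fail: "\<lbrakk> B = mset Ns; length xs \<noteq> size B; fset Y = (fv M - set xs) \<union> fv_bag B \<rbrakk> \<Longrightarrow>
    {#ESub M xs x B#} \<longlongrightarrow>\<^sub>R {#Fail Y. Bi \<in># PER Ns#}"
| cons1: "\<lbrakk> B = mset Ns; fset Y = fv_bag B \<rbrakk> \<Longrightarrow>
    {#App (Fail X) B#} \<longlongrightarrow>\<^sub>R {#Fail (X |\<union>| Y). Bi \<in># PER Ns#}"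
| cons2: "\<lbrakk> B = mset Ns; size B + length xs \<noteq> 0; fset_of_list xs |\<inter>| Y = {||}; fset Z = fv_bag B \<rbrakk> \<Longrightarrow>
    {#ESub (Fail (fset_of_list xs |\<union>| Y)) xs x B#} \<longlongrightarrow>\<^sub>R {#Fail (Y |\<union>| Z). Bi \<in># PER Ns#}"
| cons3: "\<lbrakk> x |\<notin>| Y; fset Z = fv N \<rbrakk> \<Longrightarrow>
    {#LSub (Fail (finsert x Y)) N x#} \<longlongrightarrow>\<^sub>R {#Fail (Y |\<union>| Z)#}"
| tcont: "{#M#} \<longlongrightarrow>\<^sub>R E \<Longrightarrow> {#fill C M#} \<longlongrightarrow>\<^sub>R {#fill C M'. M' \<in># E#}"
| econt: "E \<longlongrightarrow>\<^sub>R E' \<Longrightarrow> F + E \<longlongrightarrow>\<^sub>R F + E'"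
| red_alpha: "\<lbrakk> rel_mset alpha E F; F \<longlongrightarrow>\<^sub>R F'; rel_mset alpha F' E' \<rbrakk> \<Longrightarrow> E \<longlongrightarrow>\<^sub>R E'"

section \<open>Intersection types and the type system with sharing\<close>

text \<open>
  Multiset types are non-idempotent intersections, i.e. multisets of strict types:
  \<open>{#}\<close> is \<open>\<omega>\<close>, \<open>{#\<sigma>#}\<close> is the strict type \<open>\<sigma>\<close> seen as a multiset type,
  and \<open>replicate_mset k \<sigma>\<close> is \<open>\<sigma>\<^sup>k\<close>.
\<close>

datatype sty = Unit | Arr "sty multiset" sty

type_synonym mty = "sty multiset"

type_synonym 'v ctx = "'v \<rightharpoonup> mty"

text \<open>
  Contexts are linear: the comma is the union \<open>++\<close> of contexts with disjoint domains, and there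
  is no weakening except for the empty sharing. \<open>sctx \<Gamma> xs \<sigma>\<close> is
  \<open>\<Gamma>, x1:\<sigma>, \<dots>, xk:\<sigma>\<close>.
\<close>

abbreviation sctx :: "'v ctx \<Rightarrow> 'v list \<Rightarrow> sty \<Rightarrow> 'v ctx" where
  "sctx \<Gamma> xs \<sigma> \<equiv> \<Gamma>(xs [\<mapsto>] replicate (length xs) {#\<sigma>#})"

abbreviation disj :: "'v ctx \<Rightarrow> 'v ctx \<Rightarrow> bool" where
  "disj \<Gamma> \<Delta> \<equiv> dom \<Gamma> \<inter> dom \<Delta> = {}"

inductive
  wt :: "'v ctx \<Rightarrow> 'v expr \<Rightarrow> sty \<Rightarrow> bool" (\<open>(_ / \<turnstile> _ / \<Colon> _)\<close> [51, 51, 51] 50)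
  and wt_bag :: "'v ctx \<Rightarrow> 'v bag \<Rightarrow> mty \<Rightarrow> bool" (\<open>(_ / \<turnstile>\<^sub>b _ / \<Colon> _)\<close> [51, 51, 51] 50)
where
  TS_var: "[x \<mapsto> {#\<sigma>#}] \<turnstile> {#Var x#} \<Colon> \<sigma>"
| TS_one: "Map.empty \<turnstile>\<^sub>b {#} \<Colon> {#}"
| TS_bag: "\<lbrakk> \<Gamma> \<turnstile> {#M#} \<Colon> \<sigma>; \<Delta> \<turnstile>\<^sub>b B \<Colon> replicate_mset k \<sigma>; disj \<Gamma> \<Delta> \<rbrakk> \<Longrightarrow>
    \<Gamma> ++ \<Delta> \<turnstile>\<^sub>b add_mset M B \<Colon> replicate_mset (Suc k) \<sigma>"
| TS_weak: "\<lbrakk> \<Gamma> \<turnstile> {#M#} \<Colon> \<tau>; x \<notin> dom \<Gamma> \<rbrakk> \<Longrightarrow> \<Gamma>(x \<mapsto> {#}) \<turnstile> {#Share M [] x#} \<Colon> \<tau>"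
| TS_shar: "\<lbrakk> sctx \<Gamma> xs \<sigma> \<turnstile> {#M#} \<Colon> \<tau>; distinct xs; set xs \<inter> dom \<Gamma> = {}; x \<notin> dom \<Gamma>;
      length xs = k; k \<noteq> 0 \<rbrakk> \<Longrightarrow>
    \<Gamma>(x \<mapsto> replicate_mset k \<sigma>) \<turnstile> {#Share M xs x#} \<Colon> \<tau>"
| TS_abs: "\<lbrakk> \<Gamma>(x \<mapsto> replicate_mset k \<sigma>) \<turnstile> {#Share M xs x#} \<Colon> \<tau>; x \<notin> dom \<Gamma> \<rbrakk> \<Longrightarrow>
    \<Gamma> \<turnstile> {#Lam M xs x#} \<Colon> Arr (replicate_mset k \<sigma>) \<tau>"
| TS_app: "\<lbrakk> \<Gamma> \<turnstile> {#M#} \<Colon> Arr \<pi> \<tau>; \<Delta> \<turnstile>\<^sub>b B \<Colon> \<pi>; disj \<Gamma> \<Delta> \<rbrakk> \<Longrightarrow>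
    \<Gamma> ++ \<Delta> \<turnstile> {#App M B#} \<Colon> \<tau>"
| TS_ex_sub: "\<lbrakk> \<Gamma>(x \<mapsto> replicate_mset k \<sigma>) \<turnstile> {#Share M xs x#} \<Colon> \<tau>; x \<notin> dom \<Gamma>;
      \<Delta> \<turnstile>\<^sub>b B \<Colon> replicate_mset k \<sigma>; disj \<Gamma> \<Delta> \<rbrakk> \<Longrightarrow>
    \<Gamma> ++ \<Delta> \<turnstile> {#ESub M xs x B#} \<Colon> \<tau>"
| TS_ex_lin_sub: "\<lbrakk> \<Gamma>(x \<mapsto> {#\<sigma>#}) \<turnstile> {#M#} \<Colon> \<tau>; x \<notin> dom \<Gamma>; \<Delta> \<turnstile> {#N#} \<Colon> \<sigma>; disj \<Gamma> \<Delta> \<rbrakk> \<Longrightarrow>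
    \<Gamma> ++ \<Delta> \<turnstile> {#LSub M N x#} \<Colon> \<tau>"
| TS_sum: "\<lbrakk> \<Gamma> \<turnstile> E \<Colon> \<tau>; \<Gamma> \<turnstile> F \<Colon> \<tau> \<rbrakk> \<Longrightarrow> \<Gamma> \<turnstile> E + F \<Colon> \<tau>"

section \<open>Well-formedness\<close>

inductive
  wf_expr :: "'v ctx \<Rightarrow> 'v expr \<Rightarrow> sty \<Rightarrow> bool" (\<open>(_ / \<Turnstile> _ / \<Colon> _)\<close> [51, 51, 51] 50)
  and wf_bag :: "'v ctx \<Rightarrow> 'v bag \<Rightarrow> mty \<Rightarrow> bool" (\<open>(_ / \<Turnstile>\<^sub>b _ / \<Colon> _)\<close> [51, 51, 51] 50)
where
  FS_wf_expr: "\<Gamma> \<turnstile> E \<Colon> \<tau> \<Longrightarrow> \<Gamma> \<Turnstile> E \<Colon> \<tau>"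
| FS_wf_bag: "\<Gamma> \<turnstile>\<^sub>b B \<Colon> \<pi> \<Longrightarrow> \<Gamma> \<Turnstile>\<^sub>b B \<Colon> \<pi>"
| FS_bag: "\<lbrakk> \<Gamma> \<Turnstile> {#M#} \<Colon> \<sigma>; \<Delta> \<Turnstile>\<^sub>b B \<Colon> replicate_mset k \<sigma>; disj \<Gamma> \<Delta> \<rbrakk> \<Longrightarrow>
    \<Gamma> ++ \<Delta> \<Turnstile>\<^sub>b add_mset M B \<Colon> replicate_mset (Suc k) \<sigma>"
| FS_weak: "\<lbrakk> \<Gamma> \<Turnstile> {#M#} \<Colon> \<tau>; x \<notin> dom \<Gamma> \<rbrakk> \<Longrightarrow> \<Gamma>(x \<mapsto> {#}) \<Turnstile> {#Share M [] x#} \<Colon> \<tau>"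
| FS_shar: "\<lbrakk> sctx \<Gamma> xs \<sigma> \<Turnstile> {#M#} \<Colon> \<tau>; distinct xs; set xs \<inter> dom \<Gamma> = {}; x \<notin> dom \<Gamma>;
      length xs = k; k \<noteq> 0 \<rbrakk> \<Longrightarrow>
    \<Gamma>(x \<mapsto> replicate_mset k \<sigma>) \<Turnstile> {#Share M xs x#} \<Colon> \<tau>"
| FS_abs: "\<lbrakk> \<Gamma>(x \<mapsto> replicate_mset k \<sigma>) \<Turnstile> {#Share M xs x#} \<Colon> \<tau>; x \<notin> dom \<Gamma> \<rbrakk> \<Longrightarrow>
    \<Gamma> \<Turnstile> {#Lam M xs x#} \<Colon> Arr (replicate_mset k \<sigma>) \<tau>"
| FS_app: "\<lbrakk> \<Gamma> \<Turnstile> {#M#} \<Colon> Arr (replicate_mset j \<sigma>) \<tau>; \<Delta> \<Turnstile>\<^sub>b B \<Colon> replicate_mset k \<sigma>;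
      disj \<Gamma> \<Delta> \<rbrakk> \<Longrightarrow>
    \<Gamma> ++ \<Delta> \<Turnstile> {#App M B#} \<Colon> \<tau>"
| FS_ex_sub: "\<lbrakk> \<Gamma>(x \<mapsto> replicate_mset k \<sigma>) \<Turnstile> {#Share M xs x#} \<Colon> \<tau>; x \<notin> dom \<Gamma>;
      \<Delta> \<Turnstile>\<^sub>b B \<Colon> replicate_mset j \<sigma>; disj \<Gamma> \<Delta> \<rbrakk> \<Longrightarrow>
    \<Gamma> ++ \<Delta> \<Turnstile> {#ESub M xs x B#} \<Colon> \<tau>"
| FS_ex_lin_sub: "\<lbrakk> \<Gamma>(x \<mapsto> {#\<sigma>#}) \<Turnstile> {#M#} \<Colon> \<tau>; x \<notin> dom \<Gamma>; \<Delta> \<Turnstile> {#N#} \<Colon> \<sigma>; disj \<Gamma> \<Delta> \<rbrakk> \<Longrightarrow>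
    \<Gamma> ++ \<Delta> \<Turnstile> {#LSub M N x#} \<Colon> \<tau>"
| FS_fail: "dom \<Gamma> = fset X \<Longrightarrow> \<Gamma> \<Turnstile> {#Fail X#} \<Colon> \<tau>"
| FS_sum: "\<lbrakk> \<Gamma> \<Turnstile> E \<Colon> \<tau>; \<Gamma> \<Turnstile> F \<Colon> \<tau> \<rbrakk> \<Longrightarrow> \<Gamma> \<Turnstile> E + F \<Colon> \<tau>"

end

theory Submission
  imports Defs
begin

text \<open>
  Well-formedness is equivalent to a syntax-directed system on single terms in which the rules
  inherited from typability are absorbed and sums have disappeared: an expression is well-formed
  iff it is nonempty and all its summands have the same type in the same context. Contexts are
  linear, so their domain is exactly the set of free names; this types the failure terms produced
  by a reduction. A head variable has a single occurrence and consumes its whole type,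
  which gives the linear substitution lemma. Since reduction is closed under renaming, typing must
  also be invariant under alpha-equivalence; this follows from equivariance, because a swapping of
  names outside the domain of a context fixes the context.
\<close>

section \<open>Syntax-directed well-formedness\<close>

text \<open>
  \<open>typed_bag \<Gamma> B \<sigma>\<close> corresponds to the multiset type \<open>replicate_mset (size B) \<sigma>\<close>; the empty bag
  is thus typed by every \<open>\<sigma>\<close>.
\<close>

inductive typed :: "'v ctx \<Rightarrow> 'v tm \<Rightarrow> sty \<Rightarrow> bool"
  and typed_bag :: "'v ctx \<Rightarrow> 'v bag \<Rightarrow> sty \<Rightarrow> bool"
where
  typed_Var: "typed [x \<mapsto> {#\<sigma>#}] (Var x) \<sigma>"
| typed_Fail: "dom \<Gamma> = fset X \<Longrightarrow> typed \<Gamma> (Fail X) \<tau>"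
| typed_Share: "\<lbrakk> typed (sctx \<Gamma> xs \<sigma>) M \<tau>; distinct xs; set xs \<inter> dom \<Gamma> = {}; x \<notin> dom \<Gamma> \<rbrakk> \<Longrightarrow>
    typed (\<Gamma>(x \<mapsto> replicate_mset (length xs) \<sigma>)) (Share M xs x) \<tau>"
| typed_Lam: "\<lbrakk> typed (\<Gamma>(x \<mapsto> replicate_mset k \<sigma>)) (Share M xs x) \<tau>; x \<notin> dom \<Gamma> \<rbrakk> \<Longrightarrow>
    typed \<Gamma> (Lam M xs x) (Arr (replicate_mset k \<sigma>) \<tau>)"
| typed_App: "\<lbrakk> typed \<Gamma> M (Arr (replicate_mset k \<sigma>) \<tau>); typed_bag \<Delta> B \<sigma>; disj \<Gamma> \<Delta> \<rbrakk> \<Longrightarrow>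
    typed (\<Gamma> ++ \<Delta>) (App M B) \<tau>"
| typed_ESub: "\<lbrakk> typed (\<Gamma>(x \<mapsto> replicate_mset k \<sigma>)) (Share M xs x) \<tau>; x \<notin> dom \<Gamma>;
      typed_bag \<Delta> B \<sigma>; disj \<Gamma> \<Delta> \<rbrakk> \<Longrightarrow>
    typed (\<Gamma> ++ \<Delta>) (ESub M xs x B) \<tau>"
| typed_LSub: "\<lbrakk> typed (\<Gamma>(x \<mapsto> {#\<sigma>#})) M \<tau>; x \<notin> dom \<Gamma>; typed \<Delta> N \<sigma>; disj \<Gamma> \<Delta> \<rbrakk> \<Longrightarrow>
    typed (\<Gamma> ++ \<Delta>) (LSub M N x) \<tau>"
| typed_bag_empty: "typed_bag Map.empty {#} \<sigma>"
| typed_bag_add: "\<lbrakk> typed \<Gamma> M \<sigma>; typed_bag \<Delta> B \<sigma>; disj \<Gamma> \<Delta> \<rbrakk> \<Longrightarrow>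
    typed_bag (\<Gamma> ++ \<Delta>) (add_mset M B) \<sigma>"

inductive_cases typed_VarE: "typed \<Gamma> (Var x) \<tau>"
inductive_cases typed_FailE: "typed \<Gamma> (Fail X) \<tau>"
inductive_cases typed_ShareE: "typed \<Gamma> (Share M xs x) \<tau>"
inductive_cases typed_LamE: "typed \<Gamma> (Lam M xs x) \<tau>"
inductive_cases typed_AppE: "typed \<Gamma> (App M B) \<tau>"
inductive_cases typed_ESubE: "typed \<Gamma> (ESub M xs x B) \<tau>"
inductive_cases typed_LSubE: "typed \<Gamma> (LSub M N x) \<tau>"
inductive_cases typed_bag_emptyE: "typed_bag \<Gamma> {#} \<sigma>"

text \<open>The size recovers the exponent, but only a nonzero power recovers its base:
  \<open>{#}\<close> is the zeroth power of every strict type. This ambiguity recurs below.\<close>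

lemma replicate_mset_eq_iff:
  "replicate_mset m a = replicate_mset n b \<longleftrightarrow> m = n \<and> (m = 0 \<or> a = b)"
  by (metis in_replicate_mset replicate_mset_0 size_replicate_mset gr0I)

section \<open>Equivalence of the two systems\<close>

abbreviation typed_expr :: "'v ctx \<Rightarrow> 'v expr \<Rightarrow> sty \<Rightarrow> bool" where
  "typed_expr \<Gamma> E \<tau> \<equiv> E \<noteq> {#} \<and> (\<forall>M \<in># E. typed \<Gamma> M \<tau>)"

text \<open>Mediates between multiset types and strict types. The base is quantified universally
  because \<open>{#}\<close> does not determine it; the existential conjunct fixes the exponent and
  keeps the universal one from holding vacuously.\<close>

abbreviation typed_mbag :: "'v ctx \<Rightarrow> 'v bag \<Rightarrow> mty \<Rightarrow> bool" where
  "typed_mbag \<Gamma> B \<pi> \<equiv> (\<exists>\<sigma>. \<pi> = replicate_mset (size B) \<sigma>) \<and>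
     (\<forall>\<sigma>. \<pi> = replicate_mset (size B) \<sigma> \<longrightarrow> typed_bag \<Gamma> B \<sigma>)"

lemma typed_mbag_empty: "typed_mbag Map.empty {#} {#}"
  by (auto intro: typed_bag_empty)

lemma typed_mbag_replicate:
  assumes "typed_mbag \<Delta> B (replicate_mset k \<sigma>)"
  shows "typed_bag \<Delta> B \<sigma>"
  using assms by (auto simp: replicate_mset_eq_iff)

text \<open>The new exponent is a successor, so the base is determined and a single typing settles
  the universal conjunct.\<close>

lemma typed_mbag_add:
  assumes "typed \<Gamma> M \<sigma>" and B: "typed_mbag \<Delta> B (replicate_mset k \<sigma>)" and "disj \<Gamma> \<Delta>"
  shows "typed_mbag (\<Gamma> ++ \<Delta>) (add_mset M B) (replicate_mset (Suc k) \<sigma>)"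
proof -
  have "typed_bag (\<Gamma> ++ \<Delta>) (add_mset M B) \<sigma>"
    using assms typed_mbag_replicate[OF B] by (intro typed_bag_add)
  moreover have "k = size B"
    using B by (auto simp: replicate_mset_eq_iff)
  ultimately show ?thesis
    unfolding size_add_mset replicate_mset_eq_iff by blast
qed

lemma wt_typed: "\<Gamma> \<turnstile> E \<Colon> \<tau> \<Longrightarrow> typed_expr \<Gamma> E \<tau>"
  and wt_bag_typed: "\<Gamma> \<turnstile>\<^sub>b B \<Colon> \<pi> \<Longrightarrow> typed_mbag \<Gamma> B \<pi>"
  supply fun_upd_apply [simp del]
proof (induction rule: wt_wt_bag.inducts)
  case TS_one
  show ?case by (rule typed_mbag_empty)
next
  case (TS_bag \<Gamma> M \<sigma> \<Delta> B k)
  then show ?case by (intro typed_mbag_add) auto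
next
  \<comment> \<open>Weakening is sharing over the empty list, with the zeroth power as the type of
    \<open>x\<close>.\<close>
  case (TS_weak \<Gamma> M \<tau> x)
  then show ?case using typed_Share[of \<Gamma> "[]" _ M \<tau> x] by simp
next
  \<comment> \<open>The rule allows any \<open>\<pi>\<close>; the induction hypothesis for the bag
    shows that it is a power, as \<open>typed_App\<close> requires.\<close>
  case (TS_app \<Gamma> M \<pi> \<tau> \<Delta> B)
  then show ?case by (auto intro: typed_App)
next
  case (TS_ex_sub \<Gamma> x k \<sigma> M xs \<tau> \<Delta> B)
  then have "typed_bag \<Delta> B \<sigma>" by (intro typed_mbag_replicate)
  with TS_ex_sub show ?case by (auto intro: typed_ESub)
qed (auto intro: typed_typed_bag.intros)

lemma wf_typed: "\<Gamma> \<Turnstile> E \<Colon> \<tau> \<Longrightarrow> typed_expr \<Gamma> E \<tau>"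
  and wf_bag_typed: "\<Gamma> \<Turnstile>\<^sub>b B \<Colon> \<pi> \<Longrightarrow> typed_mbag \<Gamma> B \<pi>"
  supply fun_upd_apply [simp del]
proof (induction rule: wf_expr_wf_bag.inducts)
  case (FS_wf_expr \<Gamma> E \<tau>)
  then show ?case by (rule wt_typed)
next
  case (FS_wf_bag \<Gamma> B \<pi>)
  then show ?case by (rule wt_bag_typed)
next
  case (FS_bag \<Gamma> M \<sigma> \<Delta> B k)
  then show ?case by (intro typed_mbag_add) auto
next
  case (FS_weak \<Gamma> M \<tau> x)
  then show ?case using typed_Share[of \<Gamma> "[]" _ M \<tau> x] by simp
next
  case (FS_app \<Gamma> M j \<sigma> \<tau> \<Delta> B k)
  then have "typed_bag \<Delta> B \<sigma>" by (intro typed_mbag_replicate)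
  with FS_app show ?case by (auto intro: typed_App)
next
  case (FS_ex_sub \<Gamma> x k \<sigma> M xs \<tau> \<Delta> B j)
  then have "typed_bag \<Delta> B \<sigma>" by (intro typed_mbag_replicate)
  with FS_ex_sub show ?case by (auto intro: typed_ESub)
qed (auto intro: typed_typed_bag.intros)

lemma typed_wf: "typed \<Gamma> M \<tau> \<Longrightarrow> \<Gamma> \<Turnstile> {#M#} \<Colon> \<tau>"
  and typed_wf_bag: "typed_bag \<Gamma> B \<sigma> \<Longrightarrow> \<Gamma> \<Turnstile>\<^sub>b B \<Colon> replicate_mset (size B) \<sigma>"
  supply fun_upd_apply [simp del]
proof (induction rule: typed_typed_bag.inducts)
  \<comment> \<open>The single sharing rule splits again: an empty list is weakening, a nonempty one
    has \<open>k \<noteq> 0\<close>.\<close>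
  case (typed_Share \<Gamma> xs \<sigma> M \<tau> x)
  then show ?case
    by (cases "xs = []")
      (use FS_weak[of \<Gamma> M \<tau> x] FS_shar[of \<Gamma> xs \<sigma> M \<tau> x] in \<open>simp_all\<close>)
next
  case (typed_bag_add \<Gamma> M \<sigma> \<Delta> B)
  then show ?case using FS_bag[of \<Gamma> M \<sigma> \<Delta> B "size B"] by simp
next
  \<comment> \<open>Well-formedness has no axiom of its own for the empty bag; it is inherited from
    typability.\<close>
  case (typed_bag_empty \<sigma>)
  then show ?case using FS_wf_bag[OF TS_one] by simp
qed (auto intro: wf_expr_wf_bag.intros wt_wt_bag.intros)

lemma wf_iff_typed: "\<Gamma> \<Turnstile> E \<Colon> \<tau> \<longleftrightarrow> typed_expr \<Gamma> E \<tau>"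
proof
  show "\<Gamma> \<Turnstile> E \<Colon> \<tau>" if "typed_expr \<Gamma> E \<tau>"
    using that
  proof (induction E)
    case (add M E)
    \<comment> \<open>A last summand is kept apart, since \<open>FS_sum\<close> needs both parts
      well-formed and the empty sum never is.\<close>
    then show ?case
      using FS_sum[of \<Gamma> "{#M#}" \<tau> E] typed_wf by (cases "E = {#}") auto
  qed simp
qed (rule wf_typed)

section \<open>Contexts and free names\<close>

lemma fv_App: "fv (App M B) = fv M \<union> fv_bag B"
  and fv_ESub: "fv (ESub M xs x B) = fv (Share M xs x) - {x} \<union> fv_bag B"
  by (auto simp: fv_bag_def)

lemma fv_bag_empty [simp]: "fv_bag {#} = {}"
  and fv_bag_add_mset [simp]: "fv_bag (add_mset N B) = fv N \<union> fv_bag B"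
  by (auto simp: fv_bag_def)

text \<open>No rule leaves spare names in a context, and the side conditions make each binder remove
  exactly the names it had added. Freshness conditions on free names thereby become conditions on
  domains.\<close>

lemma typed_dom: "typed \<Gamma> M \<tau> \<Longrightarrow> dom \<Gamma> = fv M"
  and typed_bag_dom: "typed_bag \<Gamma> B \<sigma> \<Longrightarrow> dom \<Gamma> = fv_bag B"
  supply fun_upd_apply [simp del]
proof (induction rule: typed_typed_bag.inducts)
  case (typed_LSub \<Gamma> x \<sigma> M \<tau> \<Delta> N)
  then show ?case by (auto simp del: domIff)
next
  case (typed_App \<Gamma> M k \<sigma> \<tau> \<Delta> B)
  then show ?case unfolding fv_App by auto
next
  case (typed_ESub \<Gamma> x k \<sigma> M xs \<tau> \<Delta> B)
  from typed_ESub show ?case unfolding fv_ESub by auto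
next
  case (typed_Share \<Gamma> xs \<sigma> M \<tau> x)
  then have "dom \<Gamma> \<union> set xs = fv M" by auto
  then show ?case using typed_Share.hyps by auto
next
  case (typed_Lam \<Gamma> x k \<sigma> M xs \<tau>)
  then show ?case by auto
qed auto

text \<open>All shared names receive the same type, so only membership in the list matters.\<close>

lemma sctx_apply: "sctx \<Gamma> xs \<sigma> v = (if v \<in> set xs then Some {#\<sigma>#} else \<Gamma> v)"
  by (induction xs arbitrary: \<Gamma>) auto

text \<open>The derivation may have listed the bag in another order.\<close>

lemma typed_bag_addE:
  assumes "typed_bag \<Gamma> (add_mset N B) \<sigma>"
  obtains \<Gamma>\<^sub>1 \<Gamma>\<^sub>2 where "\<Gamma> = \<Gamma>\<^sub>1 ++ \<Gamma>\<^sub>2" "disj \<Gamma>\<^sub>1 \<Gamma>\<^sub>2" "typed \<Gamma>\<^sub>1 N \<sigma>" "typed_bag \<Gamma>\<^sub>2 B \<sigma>"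
proof -
  have "\<exists>\<Gamma>\<^sub>1 \<Gamma>\<^sub>2. \<Gamma> = \<Gamma>\<^sub>1 ++ \<Gamma>\<^sub>2 \<and> disj \<Gamma>\<^sub>1 \<Gamma>\<^sub>2 \<and> typed \<Gamma>\<^sub>1 N \<sigma> \<and> typed_bag \<Gamma>\<^sub>2 B \<sigma>"
    using assms
  proof (induction B arbitrary: \<Gamma> rule: measure_induct_rule[where f = size])
    case (less B)
    from less.prems show ?case
    proof (cases rule: typed_bag.cases)
      case (typed_bag_add \<Gamma>' M \<Delta> B')
      show ?thesis
      proof (cases "M = N")
        case True
        then show ?thesis using typed_bag_add by auto
      next
        case False
        \<comment> \<open>If the derivation split off another element \<open>M\<close>, then
          \<open>N\<close> lies in its remainder. Removing both leaves \<open>C\<close>, which is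
          smaller than \<open>B\<close>; hence the induction on the size.\<close>
        then obtain C where C: "B = add_mset M C" "B' = add_mset N C"
          using typed_bag_add(2) by (auto simp: add_eq_conv_ex)
        then obtain \<Delta>\<^sub>1 \<Delta>\<^sub>2 where \<Delta>: "\<Delta> = \<Delta>\<^sub>1 ++ \<Delta>\<^sub>2" "disj \<Delta>\<^sub>1 \<Delta>\<^sub>2" "typed \<Delta>\<^sub>1 N \<sigma>" "typed_bag \<Delta>\<^sub>2 C \<sigma>"
          using less.IH[of C \<Delta>] typed_bag_add by auto
        have "\<Gamma>' ++ \<Delta>\<^sub>1 = \<Delta>\<^sub>1 ++ \<Gamma>'"
          using typed_bag_add \<Delta>(1) by (intro map_add_comm) auto
        then have "\<Gamma> = \<Delta>\<^sub>1 ++ (\<Gamma>' ++ \<Delta>\<^sub>2)" "disj \<Delta>\<^sub>1 (\<Gamma>' ++ \<Delta>\<^sub>2)" "disj \<Gamma>' \<Delta>\<^sub>2"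
          using typed_bag_add \<Delta> by (auto simp: map_add_assoc map_add_comm Int_commute)
        then show ?thesis
          using \<Delta> typed_bag_add C by (metis typed_typed_bag.typed_bag_add)
      qed
    qed auto
  qed
  then show ?thesis using that by blast
qed

section \<open>Renaming\<close>

text \<open>An involution is injective, so taking images commutes with the set differences at
  binders.\<close>

lemma fv_map_tm:
  assumes "\<And>v. p (p v) = v"
  shows "fv (map_tm p M) = p ` fv M"
proof -
  have *: "inj p" by (metis assms injI)
  show ?thesis
    by (induction M) (simp_all add: image_Un image_set_diff[OF *] image_UN)
qed

text \<open>Equivariance. As \<open>p\<close> is its own inverse, \<open>\<Gamma> \<circ> p\<close>
  is the renamed context: it gives \<open>p v\<close> the type of \<open>v\<close>.\<close>

lemma typed_map_tm:
  fixes p :: "'v \<Rightarrow> 'v"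
  assumes p: "\<And>v. p (p v) = v"
  shows "typed \<Gamma> M \<tau> \<Longrightarrow> typed (\<Gamma> \<circ> p) (map_tm p M) \<tau>"
    and "typed_bag \<Gamma> B \<sigma> \<Longrightarrow> typed_bag (\<Gamma> \<circ> p) (image_mset (map_tm p) B) \<sigma>"
  supply fun_upd_apply [simp del]
proof (induction rule: typed_typed_bag.inducts)
  note [simp] = p
  have inj: "inj p" by (metis p injI)
  have dom_comp: "dom (\<Gamma> \<circ> p) = p ` dom \<Gamma>" for \<Gamma> :: "'v ctx"
    by (force simp: dom_def image_iff)
  have upd: "\<Gamma>(x \<mapsto> \<pi>) \<circ> p = (\<Gamma> \<circ> p)(p x \<mapsto> \<pi>)" for \<Gamma> :: "'v ctx" and x \<pi>
    by (auto simp: fun_eq_iff fun_upd_apply)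
  have add: "(\<Gamma> ++ \<Delta>) \<circ> p = (\<Gamma> \<circ> p) ++ (\<Delta> \<circ> p)" for \<Gamma> \<Delta> :: "'v ctx"
    by (simp add: fun_eq_iff map_add_def comp_def)
  have disj: "disj (\<Gamma> \<circ> p) (\<Delta> \<circ> p)" if "disj \<Gamma> \<Delta>" for \<Gamma> \<Delta> :: "'v ctx"
    using that by (auto simp: dom_def)
  {
    case (typed_Var x \<sigma>)
    show ?case unfolding upd using typed_typed_bag.typed_Var by (simp add: comp_def)
  next
    case (typed_Fail \<Gamma> X \<tau>)
    have "dom (\<Gamma> \<circ> p) = p ` dom \<Gamma>" by (rule dom_comp)
    with typed_Fail show ?case unfolding tm.map by (intro typed_typed_bag.typed_Fail) (simp del: o_apply)
  next
    case (typed_Share \<Gamma> xs \<sigma> M \<tau> x)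
    have "sctx \<Gamma> xs \<sigma> \<circ> p = sctx (\<Gamma> \<circ> p) (map p xs) \<sigma>"
    proof
      fix v
      have "p v \<in> set xs \<longleftrightarrow> v \<in> p ` set xs"
        by (metis image_iff p)
      then show "(sctx \<Gamma> xs \<sigma> \<circ> p) v = sctx (\<Gamma> \<circ> p) (map p xs) \<sigma> v"
        unfolding comp_def sctx_apply by simp
    qed
    with typed_Share.IH have "typed (sctx (\<Gamma> \<circ> p) (map p xs) \<sigma>) (map_tm p M) \<tau>" by simp
    moreover have "set (map p xs) \<inter> dom (\<Gamma> \<circ> p) = {}"
      using typed_Share.hyps(3) by (simp add: dom_comp flip: image_Int[OF inj])
    moreover have "distinct (map p xs)"
      using typed_Share.hyps(2) by (simp add: distinct_map inj_on_subset[OF inj])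
    moreover have "p x \<notin> dom (\<Gamma> \<circ> p)"
      using typed_Share.hyps(4) by (simp add: domIff)
    ultimately have "typed ((\<Gamma> \<circ> p)(p x \<mapsto> replicate_mset (length (map p xs)) \<sigma>))
        (Share (map_tm p M) (map p xs) (p x)) \<tau>"
      by (intro typed_typed_bag.typed_Share)
    then show ?case by (simp add: upd)
  next
    case (typed_Lam \<Gamma> x k \<sigma> M xs \<tau>)
    have "p x \<notin> dom (\<Gamma> \<circ> p)" using typed_Lam.hyps by (simp add: domIff)
    with typed_Lam.IH show ?case unfolding upd tm.map by (intro typed_typed_bag.typed_Lam)
  next
    case (typed_App \<Gamma> M k \<sigma> \<tau> \<Delta> B)
    show ?case unfolding add tm.map
      using typed_App.IH disj[OF typed_App.hyps(3)] by (rule typed_typed_bag.typed_App)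
  next
    case (typed_ESub \<Gamma> x k \<sigma> M xs \<tau> \<Delta> B)
    have "p x \<notin> dom (\<Gamma> \<circ> p)" using typed_ESub.hyps(2) by (simp add: domIff)
    with typed_ESub.IH disj[OF typed_ESub.hyps(4)] show ?case unfolding upd add tm.map
      by (intro typed_typed_bag.typed_ESub)
  next
    case (typed_LSub \<Gamma> x \<sigma> M \<tau> \<Delta> N)
    have "p x \<notin> dom (\<Gamma> \<circ> p)" using typed_LSub.hyps(2) by (simp add: domIff)
    with typed_LSub.IH disj[OF typed_LSub.hyps(4)] show ?case unfolding upd add tm.map
      by (intro typed_typed_bag.typed_LSub)
  next
    case (typed_bag_empty \<sigma>)
    then show ?case by (simp add: comp_def typed_typed_bag.typed_bag_empty)
  next
    case (typed_bag_add \<Gamma> M \<sigma> \<Delta> B)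
    show ?case unfolding add image_mset_add_mset
      using typed_bag_add.IH disj[OF typed_bag_add.hyps(3)] by (rule typed_typed_bag.typed_bag_add)
  }
qed

lemma map_tm_involution:
  assumes "\<And>v. p (p v) = v"
  shows "map_tm p (map_tm p M) = M"
  using assms by (simp add: tm.map_comp comp_def tm.map_ident)

section \<open>Invariance of typing under alpha-equivalence\<close>

lemma comp_transpose_fresh:
  assumes "a \<notin> dom \<Gamma>" "b \<notin> dom \<Gamma>"
  shows "\<Gamma> \<circ> transpose a b = \<Gamma>"
  using assms by (auto simp: fun_eq_iff transpose_def domIff)

text \<open>The swapping acts on the whole abstraction, so equivariance applies directly; both names
  avoid the domain, which is the set of free names.\<close>

lemma typed_swap_Lam:
  assumes "a \<notin> fv (Lam M xs x)" "b \<notin> fv (Lam M xs x)" "typed \<Gamma> (Lam M xs x) \<tau>"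
  shows "typed \<Gamma> (map_tm (transpose a b) (Lam M xs x)) \<tau>"
  using typed_map_tm(1)[OF _ assms(3), of "transpose a b"] assms(1,2)
    comp_transpose_fresh[of a \<Gamma> b] typed_dom[OF assms(3)]
  by simp

text \<open>For the scope of a binder, whose bound name may itself be \<open>a\<close> or
  \<open>b\<close>: only its entry moves.\<close>

lemma comp_transpose_upd:
  assumes "a \<notin> dom \<Gamma>" "b \<notin> dom \<Gamma>"
  shows "\<Gamma>(x \<mapsto> \<pi>) \<circ> transpose a b = \<Gamma>(transpose a b x \<mapsto> \<pi>)"
    and "x \<notin> dom \<Gamma> \<Longrightarrow> transpose a b x \<notin> dom \<Gamma>"
  using assms by (auto simp: fun_eq_iff transpose_def domIff)

text \<open>\<open>N\<close> lies outside the scope of \<open>x\<close>, so equivariance is used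
  only for the premise that types \<open>M\<close>, and \<open>\<Delta>\<close> stays as it
  is.\<close>

lemma typed_swap_LSub:
  assumes "a \<notin> fv M - {x}" "b \<notin> fv M - {x}" "typed \<Gamma> (LSub M N x) \<tau>"
  shows "typed \<Gamma> (LSub (map_tm (transpose a b) M) N (transpose a b x)) \<tau>"
proof -
  from assms(3) obtain \<Gamma>' \<sigma> \<Delta> where 1: "\<Gamma> = \<Gamma>' ++ \<Delta>" "typed (\<Gamma>'(x \<mapsto> {#\<sigma>#})) M \<tau>"
    "x \<notin> dom \<Gamma>'" "typed \<Delta> N \<sigma>" "disj \<Gamma>' \<Delta>"
    by (elim typed_LSubE)
  have fresh: "a \<notin> dom \<Gamma>'" "b \<notin> dom \<Gamma>'"
    using assms(1,2) typed_dom[OF 1(2)] 1(3) by auto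
  show ?thesis
    using typed_map_tm(1)[OF _ 1(2), of "transpose a b"] 1
    by (auto simp: comp_transpose_upd(1)[OF fresh] intro!: typed_LSub comp_transpose_upd(2)[OF fresh])
qed

lemma typed_swap_ESub:
  assumes "a \<notin> fv (Share M xs x) - {x}" "b \<notin> fv (Share M xs x) - {x}"
    "typed \<Gamma> (ESub M xs x B) \<tau>"
  shows "typed \<Gamma>
    (ESub (map_tm (transpose a b) M) (map (transpose a b) xs) (transpose a b x) B) \<tau>"
proof -
  from assms(3) obtain \<Gamma>' k \<sigma> \<Delta> where 1: "\<Gamma> = \<Gamma>' ++ \<Delta>"
    "typed (\<Gamma>'(x \<mapsto> replicate_mset k \<sigma>)) (Share M xs x) \<tau>"
    "x \<notin> dom \<Gamma>'" "typed_bag \<Delta> B \<sigma>" "disj \<Gamma>' \<Delta>"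
    by (elim typed_ESubE)
  have fresh: "a \<notin> dom \<Gamma>'" "b \<notin> dom \<Gamma>'"
    using assms(1,2) typed_dom[OF 1(2)] 1(3) by auto
  show ?thesis
    using typed_map_tm(1)[OF _ 1(2), of "transpose a b"] 1
    by (auto simp: comp_transpose_upd(1)[OF fresh] intro!: typed_ESub comp_transpose_upd(2)[OF fresh])
qed

text \<open>Here \<open>x\<close> is free and keeps its name; only the entries of the inner list
  move.\<close>

lemma typed_swap_Share:
  assumes "a \<notin> fv M - set xs" "b \<notin> fv M - set xs" "typed \<Gamma> (Share M xs x) \<tau>"
  shows "typed \<Gamma> (Share (map_tm (transpose a b) M) (map (transpose a b) xs) x) \<tau>"
proof -
  from assms(3) obtain \<Gamma>' \<sigma> where 1: "\<Gamma> = \<Gamma>'(x \<mapsto> replicate_mset (length xs) \<sigma>)"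
    "typed (sctx \<Gamma>' xs \<sigma>) M \<tau>" "distinct xs" "set xs \<inter> dom \<Gamma>' = {}" "x \<notin> dom \<Gamma>'"
    by (elim typed_ShareE)
  let ?p = "transpose a b"
  have fresh: "a \<notin> dom \<Gamma>'" "b \<notin> dom \<Gamma>'"
    using assms(1,2) typed_dom[OF 1(2)] 1(4) by auto
  have "sctx \<Gamma>' xs \<sigma> \<circ> ?p = sctx \<Gamma>' (map ?p xs) \<sigma>"
  proof
    fix v
    have "?p v \<in> set xs \<longleftrightarrow> v \<in> ?p ` set xs"
      by (metis image_iff transpose_involutory)
    then show "(sctx \<Gamma>' xs \<sigma> \<circ> ?p) v = sctx \<Gamma>' (map ?p xs) \<sigma> v"
      using comp_transpose_fresh[OF fresh] unfolding comp_def sctx_apply by (auto dest: fun_cong)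
  qed
  moreover have "set (map ?p xs) \<inter> dom \<Gamma>' = {}"
    using 1(4) comp_transpose_upd(2)[OF fresh] by auto
  moreover have "distinct (map ?p xs)"
    using 1(3) by (simp add: distinct_map inj_on_subset[OF inj_transpose])
  ultimately show ?thesis
    using typed_map_tm(1)[OF _ 1(2), of ?p] 1 typed_Share[of \<Gamma>' "map ?p xs" \<sigma> "map_tm ?p M" \<tau> x]
    by simp
qed

text \<open>The swapped scope meets the same freshness conditions, so the swapping can be undone by
  the same lemmas.\<close>

lemma fv_swap:
  assumes "a \<notin> fv M - S" "b \<notin> fv M - S"
  shows "fv (map_tm (transpose a b) M) - transpose a b ` S = fv M - S"
proof -
  have "fv (map_tm (transpose a b) M) - transpose a b ` S = transpose a b ` (fv M - S)"
    by (simp add: fv_map_tm image_set_diff)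
  also have "\<dots> = fv M - S"
    using assms by (intro transpose_image_eq) blast
  finally show ?thesis .
qed

text \<open>An equivalence, so that symmetry is immediate. In the swap cases the second direction
  swaps the same names again.\<close>

lemma alpha_typed: "M \<approx>\<^sub>\<alpha> M' \<Longrightarrow> typed \<Gamma> M \<tau> \<longleftrightarrow> typed \<Gamma> M' \<tau>"
  supply fun_upd_apply [simp del]
proof (induction arbitrary: \<Gamma> \<tau> rule: alpha.induct)
  case (alpha_Lam M xs x M' xs')
  then show ?case by (auto elim!: typed_LamE intro: typed_Lam)
next
  case (alpha_App M M' B)
  then show ?case by (auto elim!: typed_AppE intro: typed_App)
next
  case (alpha_App_bag N N' M B)
  then show ?case
    by (auto elim!: typed_AppE typed_bag_addE intro!: typed_App typed_bag_add)
next
  case (alpha_LSub M M' N N' x)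
  then show ?case by (auto elim!: typed_LSubE intro: typed_LSub)
next
  case (alpha_Share M M' xs x)
  then show ?case by (auto elim!: typed_ShareE intro: typed_Share)
next
  case (alpha_ESub M xs x M' xs' B)
  then show ?case by (auto elim!: typed_ESubE intro: typed_ESub)
next
  case (alpha_ESub_bag N N' M xs x B)
  then show ?case
    by (auto elim!: typed_ESubE typed_bag_addE intro!: typed_ESub typed_bag_add)
next
  case (swap_Lam a M xs x b)
  let ?p = "transpose a b"
  have "fv (Lam (map_tm ?p M) (map ?p xs) (?p x)) = fv (Lam M xs x)"
    using fv_swap[of a "Share M xs x" "{x}" b] swap_Lam by simp
  then show ?case
    using typed_swap_Lam[of a M xs x b \<Gamma> \<tau>] swap_Lam
      typed_swap_Lam[of a "map_tm ?p M" "map ?p xs" "?p x" b \<Gamma> \<tau>]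
    by (auto simp: map_tm_involution comp_def)
next
  case (swap_LSub a M x b N)
  let ?p = "transpose a b"
  have "fv (map_tm ?p M) - {?p x} = fv M - {x}"
    using fv_swap[of a M "{x}" b] swap_LSub by simp
  then show ?case
    using typed_swap_LSub[of a M x b \<Gamma> N \<tau>] swap_LSub
      typed_swap_LSub[of a "map_tm ?p M" "?p x" b \<Gamma> N \<tau>]
    by (auto simp: map_tm_involution)
next
  case (swap_Share a M xs b x)
  let ?p = "transpose a b"
  have "fv (map_tm ?p M) - set (map ?p xs) = fv M - set xs"
    using fv_swap[of a M "set xs" b] swap_Share by simp
  then show ?case
    using typed_swap_Share[of a M xs b \<Gamma> x \<tau>] swap_Share
      typed_swap_Share[of a "map_tm ?p M" "map ?p xs" b \<Gamma> x \<tau>]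
    by (auto simp: map_tm_involution comp_def)
next
  case (swap_ESub a M xs x b B)
  let ?p = "transpose a b"
  have "fv (Share (map_tm ?p M) (map ?p xs) (?p x)) - {?p x} = fv (Share M xs x) - {x}"
    using fv_swap[of a "Share M xs x" "{x}" b] swap_ESub by simp
  then show ?case
    using typed_swap_ESub[of a M xs x b \<Gamma> B \<tau>] swap_ESub
      typed_swap_ESub[of a "map_tm ?p M" "map ?p xs" "?p x" b \<Gamma> B \<tau>]
    by (auto simp: map_tm_involution comp_def)
qed auto

section \<open>Substitution\<close>

text \<open>With \<open>typed_dom\<close>, this locates \<open>x\<close> when a context splits: it
  belongs to the component that types the head.\<close>

lemma lin_head_subst_fv: "lin_head_subst N x M M' \<Longrightarrow> x \<in> fv M"
  by (induction rule: lin_head_subst.induct) auto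

text \<open>The witness is \<open>\<Gamma>\<^sub>1\<close> with \<open>x\<close> deleted. By
  disjointness \<open>\<Gamma>\<^sub>2\<close> lacks \<open>x\<close>, so its type is read off
  \<open>\<Gamma>\<^sub>1\<close> although \<open>++\<close> prefers the right operand.\<close>

lemma upd_eq_map_addE:
  assumes "\<Gamma>(x \<mapsto> \<pi>) = \<Gamma>\<^sub>1 ++ \<Gamma>\<^sub>2" "disj \<Gamma>\<^sub>1 \<Gamma>\<^sub>2" "x \<in> dom \<Gamma>\<^sub>1" "x \<notin> dom \<Gamma>"
  obtains \<Gamma>\<^sub>1' where "\<Gamma>\<^sub>1 = \<Gamma>\<^sub>1'(x \<mapsto> \<pi>)" "x \<notin> dom \<Gamma>\<^sub>1'" "\<Gamma> = \<Gamma>\<^sub>1' ++ \<Gamma>\<^sub>2" "disj \<Gamma>\<^sub>1' \<Gamma>\<^sub>2"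
proof
  have x: "\<Gamma>\<^sub>2 x = None" using assms(2,3) by blast
  have "\<Gamma> v = (\<Gamma>\<^sub>1(x := None) ++ \<Gamma>\<^sub>2) v" for v
    using fun_cong[OF assms(1), of v] assms(4) x
    by (cases "v = x") (auto simp: map_add_def split: option.splits)
  then show "\<Gamma> = \<Gamma>\<^sub>1(x := None) ++ \<Gamma>\<^sub>2" by blast
  have "\<Gamma>\<^sub>1 x = Some \<pi>"
    using fun_cong[OF assms(1), of x] x by (auto simp: map_add_def)
  then show "\<Gamma>\<^sub>1 = (\<Gamma>\<^sub>1(x := None))(x \<mapsto> \<pi>)" by auto
qed (use assms(2) in auto)

lemma map_add_upd_left: "x \<notin> dom \<Delta> \<Longrightarrow> \<Gamma>(x \<mapsto> \<pi>) ++ \<Delta> = (\<Gamma> ++ \<Delta>)(x \<mapsto> \<pi>)"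
  by (auto simp: fun_eq_iff map_add_def split: option.splits)

lemma map_add_sctx_left:
  "set xs \<inter> dom \<Delta> = {} \<Longrightarrow> sctx \<Gamma> xs \<sigma> ++ \<Delta> = sctx (\<Gamma> ++ \<Delta>) xs \<sigma>"
  unfolding fun_eq_iff sctx_apply map_add_def by (auto split: option.splits)

text \<open>Substitution adds \<open>\<Delta>\<close> next to the context of the head; the goal has
  it at the end.\<close>

lemma map_add_swap_right: "disj \<Gamma>' \<Delta> \<Longrightarrow> \<Gamma> ++ \<Gamma>' ++ \<Delta> = \<Gamma> ++ \<Delta> ++ \<Gamma>'"
  by (metis map_add_assoc map_add_comm)

text \<open>Along the path to the head, \<open>x\<close> stays in the component of the head, and
  \<open>\<Delta>\<close> takes its place there. \<open>\<Gamma>\<close> and \<open>\<tau>\<close>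
  vary along the path.\<close>

lemma typed_lin_head_subst:
  assumes "lin_head_subst N x M M'" "typed (\<Gamma>(x \<mapsto> {#\<sigma>#})) M \<tau>" "x \<notin> dom \<Gamma>"
    "typed \<Delta> N \<sigma>" "disj \<Gamma> \<Delta>"
  shows "typed (\<Gamma> ++ \<Delta>) M' \<tau>"
  using assms(1-3,5)
proof (induction arbitrary: \<Gamma> \<tau> rule: lin_head_subst.induct)
  case lhs_Var
  \<comment> \<open>The variable axiom has no other entry, so \<open>\<Gamma>\<close> is empty and
    \<open>N\<close> is typed in \<open>\<Delta>\<close> alone.\<close>
  then have eq: "\<Gamma>(x \<mapsto> {#\<sigma>#}) = [x \<mapsto> {#\<tau>#}]" by (blast elim: typed_VarE)
  have "\<sigma> = \<tau>" using fun_cong[OF eq, of x] by simp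
  moreover have "\<Gamma> v = None" for v
    using fun_cong[OF eq, of v] lhs_Var by (cases "v = x") (simp_all add: domIff)
  then have "\<Gamma> = Map.empty" by blast
  ultimately show ?case using assms(4) by simp
next
  case (lhs_App M M' B)
  from lhs_App.prems(1) obtain \<Gamma>\<^sub>1 \<Gamma>\<^sub>2 k \<rho> where \<Gamma>: "\<Gamma>(x \<mapsto> {#\<sigma>#}) = \<Gamma>\<^sub>1 ++ \<Gamma>\<^sub>2"
    "typed \<Gamma>\<^sub>1 M (Arr (replicate_mset k \<rho>) \<tau>)" "typed_bag \<Gamma>\<^sub>2 B \<rho>" "disj \<Gamma>\<^sub>1 \<Gamma>\<^sub>2"
    by (elim typed_AppE)
  have "x \<in> dom \<Gamma>\<^sub>1" using typed_dom[OF \<Gamma>(2)] lin_head_subst_fv[OF lhs_App.hyps(1)] by simp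
  from upd_eq_map_addE[OF \<Gamma>(1,4) this lhs_App.prems(2)] obtain \<Gamma>\<^sub>1' where
    \<Gamma>': "\<Gamma>\<^sub>1 = \<Gamma>\<^sub>1'(x \<mapsto> {#\<sigma>#})" "x \<notin> dom \<Gamma>\<^sub>1'" "\<Gamma> = \<Gamma>\<^sub>1' ++ \<Gamma>\<^sub>2" "disj \<Gamma>\<^sub>1' \<Gamma>\<^sub>2" .
  have d: "disj \<Gamma>\<^sub>1' \<Delta>" "disj \<Gamma>\<^sub>2 \<Delta>" using \<Gamma>'(3) lhs_App.prems(3) by auto
  have "typed (\<Gamma>\<^sub>1' ++ \<Delta>) M' (Arr (replicate_mset k \<rho>) \<tau>)"
    using lhs_App.IH \<Gamma>(2) \<Gamma>'(1,2) d(1) by blast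
  then have "typed (\<Gamma>\<^sub>1' ++ \<Delta> ++ \<Gamma>\<^sub>2) (App M' B) \<tau>"
    using \<Gamma>(3) \<Gamma>'(4) d by (intro typed_App) (auto simp del: fun_upd_apply)
  then show ?case using \<Gamma>'(3) map_add_swap_right[OF d(2)] by metis
next
  case (lhs_LSub M M' y L)
  from lhs_LSub.prems(1) obtain \<Gamma>\<^sub>1 \<Gamma>\<^sub>2 \<rho> where \<Gamma>: "\<Gamma>(x \<mapsto> {#\<sigma>#}) = \<Gamma>\<^sub>1 ++ \<Gamma>\<^sub>2"
    "typed (\<Gamma>\<^sub>1(y \<mapsto> {#\<rho>#})) M \<tau>" "y \<notin> dom \<Gamma>\<^sub>1" "typed \<Gamma>\<^sub>2 L \<rho>" "disj \<Gamma>\<^sub>1 \<Gamma>\<^sub>2"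
    by (elim typed_LSubE)
  have "x \<in> dom \<Gamma>\<^sub>1"
    using typed_dom[OF \<Gamma>(2)] lin_head_subst_fv[OF lhs_LSub.hyps(1)] lhs_LSub.hyps(2) by auto
  from upd_eq_map_addE[OF \<Gamma>(1,5) this lhs_LSub.prems(2)] obtain \<Gamma>\<^sub>1' where
    \<Gamma>': "\<Gamma>\<^sub>1 = \<Gamma>\<^sub>1'(x \<mapsto> {#\<sigma>#})" "x \<notin> dom \<Gamma>\<^sub>1'" "\<Gamma> = \<Gamma>\<^sub>1' ++ \<Gamma>\<^sub>2" "disj \<Gamma>\<^sub>1' \<Gamma>\<^sub>2" .
  have d: "disj \<Gamma>\<^sub>1' \<Delta>" "disj \<Gamma>\<^sub>2 \<Delta>" using \<Gamma>'(3) lhs_LSub.prems(3) by auto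
  \<comment> \<open>Capture avoidance in terms of domains: \<open>y\<close> can be bound again once
    \<open>\<Delta>\<close> has been added.\<close>
  have y: "y \<notin> dom \<Delta>" using lhs_LSub.hyps(3) typed_dom[OF assms(4)] by simp
  have "\<Gamma>\<^sub>1(y \<mapsto> {#\<rho>#}) = \<Gamma>\<^sub>1'(y \<mapsto> {#\<rho>#}, x \<mapsto> {#\<sigma>#})"
    using \<Gamma>'(1) lhs_LSub.hyps(2) by (auto simp: fun_eq_iff)
  then have "typed (\<Gamma>\<^sub>1'(y \<mapsto> {#\<rho>#}) ++ \<Delta>) M' \<tau>"
    using \<Gamma>(2) \<Gamma>'(2) d(1) y lhs_LSub.hyps(2) by (intro lhs_LSub.IH) (auto simp del: fun_upd_apply)
  then have "typed (\<Gamma>\<^sub>1' ++ \<Delta> ++ \<Gamma>\<^sub>2) (LSub M' L y) \<tau>"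
    using \<Gamma>(3,4) \<Gamma>'(1,4) d y by (intro typed_LSub) (auto simp: map_add_upd_left simp del: fun_upd_apply)
  then show ?case using \<Gamma>'(3) map_add_swap_right[OF d(2)] by metis
next
  case (lhs_Share M M' y ys)
  from lhs_Share.prems(1) obtain \<Gamma>\<^sub>1 \<rho> where
    \<Gamma>: "\<Gamma>(x \<mapsto> {#\<sigma>#}) = \<Gamma>\<^sub>1(y \<mapsto> replicate_mset (length ys) \<rho>)"
    "typed (sctx \<Gamma>\<^sub>1 ys \<rho>) M \<tau>" "distinct ys" "set ys \<inter> dom \<Gamma>\<^sub>1 = {}" "y \<notin> dom \<Gamma>\<^sub>1"
    by (elim typed_ShareE)
  \<comment> \<open>Sharing does not split the context; \<open>x\<close> is an entry of
    \<open>\<Gamma>\<^sub>1\<close> because it differs from \<open>y\<close>.\<close>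
  define \<Gamma>\<^sub>1' where "\<Gamma>\<^sub>1' = \<Gamma>\<^sub>1(x := None)"
  have \<Gamma>\<^sub>1: "\<Gamma>\<^sub>1 x = Some {#\<sigma>#}"
    using fun_cong[OF \<Gamma>(1), of x] lhs_Share.hyps(2) by simp
  have "\<Gamma> v = (\<Gamma>\<^sub>1'(y \<mapsto> replicate_mset (length ys) \<rho>)) v" for v
    using fun_cong[OF \<Gamma>(1), of v] lhs_Share.hyps(2) lhs_Share.prems(2)
    by (cases "v = x") (auto simp: \<Gamma>\<^sub>1'_def)
  then have \<Gamma>': "\<Gamma> = \<Gamma>\<^sub>1'(y \<mapsto> replicate_mset (length ys) \<rho>)" by blast
  then have "dom \<Gamma> = insert y (dom \<Gamma>\<^sub>1')" by simp
  then have d: "y \<notin> dom \<Delta>" "disj \<Gamma>\<^sub>1' \<Delta>"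
    using lhs_Share.prems(3) by blast+
  have ys: "set ys \<inter> dom \<Delta> = {}"
    using lhs_Share.hyps(4) typed_dom[OF assms(4)] by simp
  have "sctx \<Gamma>\<^sub>1 ys \<rho> = (sctx \<Gamma>\<^sub>1' ys \<rho>)(x \<mapsto> {#\<sigma>#})"
    using \<Gamma>\<^sub>1 lhs_Share.hyps(3) unfolding fun_eq_iff fun_upd_apply sctx_apply \<Gamma>\<^sub>1'_def by auto
  then have "typed (sctx \<Gamma>\<^sub>1' ys \<rho> ++ \<Delta>) M' \<tau>"
    using \<Gamma>(2) d ys lhs_Share.hyps(3) by (intro lhs_Share.IH) (auto simp: \<Gamma>\<^sub>1'_def simp del: fun_upd_apply)
  then have "typed ((\<Gamma>\<^sub>1' ++ \<Delta>)(y \<mapsto> replicate_mset (length ys) \<rho>)) (Share M' ys y) \<tau>"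
    using \<Gamma>(3-5) ys d unfolding map_add_sctx_left[OF ys]
    by (intro typed_Share) (auto simp: \<Gamma>\<^sub>1'_def simp del: fun_upd_apply)
  then show ?case using \<Gamma>' map_add_upd_left[OF d(1)] by metis
next
  case (lhs_ESub M ys y M' B)
  from lhs_ESub.prems(1) obtain \<Gamma>\<^sub>1 \<Gamma>\<^sub>2 k \<rho> where \<Gamma>: "\<Gamma>(x \<mapsto> {#\<sigma>#}) = \<Gamma>\<^sub>1 ++ \<Gamma>\<^sub>2"
    "typed (\<Gamma>\<^sub>1(y \<mapsto> replicate_mset k \<rho>)) (Share M ys y) \<tau>" "y \<notin> dom \<Gamma>\<^sub>1" "typed_bag \<Gamma>\<^sub>2 B \<rho>"
    "disj \<Gamma>\<^sub>1 \<Gamma>\<^sub>2"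
    by (elim typed_ESubE)
  have "x \<in> dom \<Gamma>\<^sub>1"
    using typed_dom[OF \<Gamma>(2)] lin_head_subst_fv[OF lhs_ESub.hyps(1)] lhs_ESub.hyps(2) by auto
  from upd_eq_map_addE[OF \<Gamma>(1,5) this lhs_ESub.prems(2)] obtain \<Gamma>\<^sub>1' where
    \<Gamma>': "\<Gamma>\<^sub>1 = \<Gamma>\<^sub>1'(x \<mapsto> {#\<sigma>#})" "x \<notin> dom \<Gamma>\<^sub>1'" "\<Gamma> = \<Gamma>\<^sub>1' ++ \<Gamma>\<^sub>2" "disj \<Gamma>\<^sub>1' \<Gamma>\<^sub>2" .
  have d: "disj \<Gamma>\<^sub>1' \<Delta>" "disj \<Gamma>\<^sub>2 \<Delta>" using \<Gamma>'(3) lhs_ESub.prems(3) by auto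
  have y: "y \<notin> dom \<Delta>" using lhs_ESub.hyps(3) typed_dom[OF assms(4)] by simp
  have "\<Gamma>\<^sub>1(y \<mapsto> replicate_mset k \<rho>) = \<Gamma>\<^sub>1'(y \<mapsto> replicate_mset k \<rho>, x \<mapsto> {#\<sigma>#})"
    using \<Gamma>'(1) lhs_ESub.hyps(2) by (auto simp: fun_eq_iff)
  then have "typed (\<Gamma>\<^sub>1'(y \<mapsto> replicate_mset k \<rho>) ++ \<Delta>) (Share M' ys y) \<tau>"
    using \<Gamma>(2) \<Gamma>'(2) d(1) y lhs_ESub.hyps(2) by (intro lhs_ESub.IH) (auto simp del: fun_upd_apply)
  then have "typed (\<Gamma>\<^sub>1' ++ \<Delta> ++ \<Gamma>\<^sub>2) (ESub M' ys y B) \<tau>"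
    using \<Gamma>(3,4) \<Gamma>'(1,4) d y by (intro typed_ESub) (auto simp: map_add_upd_left simp del: fun_upd_apply)
  then show ?case using \<Gamma>'(3) map_add_swap_right[OF d(2)] by metis
qed

text \<open>Each linear substitution trades one shared name for the part of \<open>\<Delta>\<close>
  that types its bag element. \<open>M\<close> is arbitrary because the fold builds the
  substitutions from the inside.\<close>

lemma typed_lsubs:
  assumes "length Ns = length xs" "typed (sctx \<Gamma> xs \<sigma>) M \<tau>" "typed_bag \<Delta> (mset Ns) \<sigma>"
    "distinct xs" "set xs \<inter> dom \<Gamma> = {}" "set xs \<inter> dom \<Delta> = {}" "disj \<Gamma> \<Delta>"
  shows "typed (\<Gamma> ++ \<Delta>) (lsubs M Ns xs) \<tau>"
  using assms
proof (induction Ns xs arbitrary: M \<Gamma> \<Delta> rule: list_induct2)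
  case Nil
  then show ?case by (auto simp: lsubs_def elim: typed_bag_emptyE)
next
  case (Cons N Ns x xs)
  \<comment> \<open>The bag can be split at \<open>N\<close> whatever the order in its derivation,
    so one typing of the bag serves all its permutations.\<close>
  from Cons.prems(2) obtain \<Delta>\<^sub>1 \<Delta>\<^sub>2 where
    \<Delta>: "\<Delta> = \<Delta>\<^sub>1 ++ \<Delta>\<^sub>2" "disj \<Delta>\<^sub>1 \<Delta>\<^sub>2" "typed \<Delta>\<^sub>1 N \<sigma>" "typed_bag \<Delta>\<^sub>2 (mset Ns) \<sigma>"
    by (auto elim: typed_bag_addE)
  have xs: "set xs \<inter> dom \<Delta>\<^sub>1 = {}" using Cons.prems(5) \<Delta>(1) by auto
  have "sctx \<Gamma> (x # xs) \<sigma> = (sctx \<Gamma> xs \<sigma>)(x \<mapsto> {#\<sigma>#})"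
    unfolding fun_eq_iff fun_upd_apply sctx_apply by auto
  then have "typed (sctx \<Gamma> xs \<sigma> ++ \<Delta>\<^sub>1) (LSub M N x) \<tau>"
    using Cons.prems \<Delta> by (intro typed_LSub) (auto simp del: fun_upd_apply)
  then have "typed (\<Gamma> ++ \<Delta>\<^sub>1 ++ \<Delta>\<^sub>2) (lsubs (LSub M N x) Ns xs) \<tau>"
    using Cons.prems \<Delta> unfolding map_add_sctx_left[OF xs] by (intro Cons.IH) (auto simp del: fun_upd_apply)
  then show ?case using \<Delta>(1) by (simp add: lsubs_def map_add_assoc)
qed

section \<open>Subject reduction\<close>

text \<open>The replacement property ranges over all \<open>M'\<close>, since reducing the hole
  gives a sum and each summand is plugged back.\<close>

lemma typed_fillE:
  assumes "typed \<Gamma> (fill C M) \<tau>"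
  obtains \<Gamma>' \<tau>' where "typed \<Gamma>' M \<tau>'" "\<forall>M'. typed \<Gamma>' M' \<tau>' \<longrightarrow> typed \<Gamma> (fill C M') \<tau>"
proof (cases C)
  case (CApp B)
  then show ?thesis using assms that by (auto elim!: typed_AppE intro: typed_App)
next
  case (CLSub N x)
  then show ?thesis using assms that by (fastforce elim!: typed_LSubE intro: typed_LSub)
next
  case (CShare xs x)
  then show ?thesis using assms that by (fastforce elim!: typed_ShareE intro: typed_Share)
next
  case (CESub x)
  \<comment> \<open>This context has two layers, sharing and explicit substitution, so two
    inversions are needed.\<close>
  with assms have "typed \<Gamma> (ESub M [] x {#}) \<tau>" by simp
  then obtain \<Gamma>' k \<sigma> \<Delta> where 1: "\<Gamma> = \<Gamma>' ++ \<Delta>"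
    "typed (\<Gamma>'(x \<mapsto> replicate_mset k \<sigma>)) (Share M [] x) \<tau>"
    "x \<notin> dom \<Gamma>'" "typed_bag \<Delta> {#} \<sigma>" "disj \<Gamma>' \<Delta>"
    by (elim typed_ESubE)
  from 1(2) obtain \<Theta> where
    2: "\<Gamma>'(x \<mapsto> replicate_mset k \<sigma>) = \<Theta>(x \<mapsto> {#})" "typed \<Theta> M \<tau>" "x \<notin> dom \<Theta>"
    by (elim typed_ShareE) simp
  have "typed \<Gamma> (fill C M') \<tau>" if "typed \<Theta> M' \<tau>" for M'
  proof -
    have "typed (\<Theta>(x \<mapsto> {#})) (Share M' [] x) \<tau>"
      using typed_Share[of \<Theta> "[]" _ M' \<tau> x] that 2(3) by simp
    then have "typed (\<Gamma>' ++ \<Delta>) (ESub M' [] x {#}) \<tau>"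
      using 1(3-5) unfolding 2(1)[symmetric] by (rule typed_ESub)
    then show ?thesis using 1(1) CESub by simp
  qed
  then show ?thesis using 2(2) that by blast
qed

text \<open>The identity is always a permutation, even for the empty bag, so sums over
  \<open>PER\<close> are genuine expressions.\<close>

lemma PER_nonempty: "PER Ns \<noteq> {#}"
proof -
  have "id \<in> {p. p permutes {..<length Ns}}" by (simp add: permutes_id)
  then show ?thesis unfolding PER_def
    by (metis empty_iff finite_lessThan finite_permutations image_mset_is_empty_iff
        mset_set_empty_iff infinite_set_mset_mset_set)
qed

lemma mset_PER: "Bi \<in># PER Ns \<Longrightarrow> mset Bi = mset Ns"
  unfolding PER_def by (auto simp: finite_permutations)

text \<open>Inverts both layers. The last equation is kept as it stands: for empty \<open>xs\<close>
  it does not identify \<open>\<sigma>\<close> with \<open>\<rho>\<close>.\<close>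

lemma typed_ESub_ShareE:
  assumes "typed \<Gamma> (ESub M xs x B) \<tau>"
  obtains \<Gamma>' \<Delta> \<rho> \<sigma> k where "\<Gamma> = \<Gamma>' ++ \<Delta>" "disj \<Gamma>' \<Delta>" "typed_bag \<Delta> B \<sigma>"
    "typed (sctx \<Gamma>' xs \<rho>) M \<tau>" "distinct xs" "set xs \<inter> dom \<Gamma>' = {}"
    "replicate_mset k \<sigma> = replicate_mset (length xs) \<rho>"
proof -
  from assms obtain \<Gamma>' k \<sigma> \<Delta> where 1: "\<Gamma> = \<Gamma>' ++ \<Delta>"
    "typed (\<Gamma>'(x \<mapsto> replicate_mset k \<sigma>)) (Share M xs x) \<tau>"
    "x \<notin> dom \<Gamma>'" "typed_bag \<Delta> B \<sigma>" "disj \<Gamma>' \<Delta>"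
    by (elim typed_ESubE)
  from 1(2) obtain \<Theta> \<rho> where
    2: "\<Gamma>'(x \<mapsto> replicate_mset k \<sigma>) = \<Theta>(x \<mapsto> replicate_mset (length xs) \<rho>)"
    "typed (sctx \<Theta> xs \<rho>) M \<tau>" "distinct xs" "set xs \<inter> dom \<Theta> = {}" "x \<notin> dom \<Theta>"
    by (elim typed_ShareE)
  \<comment> \<open>The updated contexts agree and neither original contains \<open>x\<close>, so
    the originals agree too.\<close>
  have "\<Gamma>' v = \<Theta> v" for v
    using fun_cong[OF 2(1), of v] 1(3) 2(5) by (cases "v = x") (simp_all add: domIff)
  then have "\<Gamma>' = \<Theta>" by blast
  moreover have "replicate_mset k \<sigma> = replicate_mset (length xs) \<rho>"
    using fun_cong[OF 2(1), of x] by simp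
  ultimately show ?thesis using that 1 2 by blast
qed

text \<open>Inverting application and abstraction gives exactly the premises of explicit
  substitution; both rules tolerate a bag of the wrong size.\<close>

lemma typed_beta:
  assumes "typed \<Gamma> (App (Lam M xs x) B) \<tau>"
  shows "typed \<Gamma> (ESub M xs x B) \<tau>"
proof -
  from assms obtain \<Gamma>' k \<sigma> \<Delta> where 1: "\<Gamma> = \<Gamma>' ++ \<Delta>"
    "typed \<Gamma>' (Lam M xs x) (Arr (replicate_mset k \<sigma>) \<tau>)" "typed_bag \<Delta> B \<sigma>" "disj \<Gamma>' \<Delta>"
    by (elim typed_AppE)
  from 1(2) have "typed (\<Gamma>'(x \<mapsto> replicate_mset k \<sigma>)) (Share M xs x) \<tau>" "x \<notin> dom \<Gamma>'"
    by (auto elim: typed_LamE)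
  then show ?thesis using 1 by (auto intro: typed_ESub)
qed

lemma typed_expr_rel_alpha:
  assumes "rel_mset alpha E F"
  shows "typed_expr \<Gamma> E \<tau> \<longleftrightarrow> typed_expr \<Gamma> F \<tau>"
proof -
  from assms obtain Ms Ns where "E = mset Ms" "F = mset Ns" "list_all2 alpha Ms Ns"
    by (auto simp: rel_mset_def)
  moreover from this(3) have "list_all (\<lambda>M. typed \<Gamma> M \<tau>) Ms \<longleftrightarrow> list_all (\<lambda>M. typed \<Gamma> M \<tau>) Ns"
    by (induction rule: list_all2_induct) (auto simp: alpha_typed)
  ultimately show ?thesis by (auto simp: list_all_iff)
qed

text \<open>Used for sum contexts, where typing \<open>F + E\<close> does not by itself exclude an
  empty \<open>E\<close>.\<close>

lemma red_nonempty: "E \<longlongrightarrow>\<^sub>R E' \<Longrightarrow> E \<noteq> {#}"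
  by (induction rule: red.induct) auto

lemma red_typed: "E \<longlongrightarrow>\<^sub>R E' \<Longrightarrow> typed_expr \<Gamma> E \<tau> \<Longrightarrow> typed_expr \<Gamma> E' \<tau>"
proof (induction arbitrary: \<Gamma> \<tau> rule: red.induct)
  case (beta M xs x B)
  then show ?case by (auto intro: typed_beta)
next
  case (ex_sub B Ns xs M x)
  from ex_sub.prems have "typed \<Gamma> (ESub M xs x B) \<tau>" by simp
  then obtain \<Gamma>' \<Delta> \<rho> \<sigma> k where *: "\<Gamma> = \<Gamma>' ++ \<Delta>" "disj \<Gamma>' \<Delta>" "typed_bag \<Delta> B \<sigma>"
    "typed (sctx \<Gamma>' xs \<rho>) M \<tau>" "distinct xs" "set xs \<inter> dom \<Gamma>' = {}"
    "replicate_mset k \<sigma> = replicate_mset (length xs) \<rho>"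
    by (elim typed_ESub_ShareE)
  \<comment> \<open>At least one name is shared, so the power is nonzero and determines its
    base.\<close>
  have [simp]: "\<rho> = \<sigma>" using *(7) ex_sub.hyps(3) by (auto simp: replicate_mset_eq_iff)
  have "typed \<Gamma> (lsubs M Bi xs) \<tau>" if "Bi \<in># PER Ns" for Bi
  proof -
    have "mset Bi = B" using mset_PER[OF that] ex_sub.hyps(1) by simp
    moreover have "length Bi = length xs"
      using \<open>mset Bi = B\<close> ex_sub.hyps(2) by (metis size_mset)
    ultimately show ?thesis
      using * ex_sub.hyps(5) typed_bag_dom[OF *(3)] unfolding *(1) by (intro typed_lsubs) auto
  qed
  then show ?case by (auto simp: PER_nonempty)
next
  case (lin_fetch M x N M')
  then have "typed \<Gamma> (LSub M N x) \<tau>" by simp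
  then have "typed \<Gamma> M' \<tau>"
    by (elim typed_LSubE) (use typed_lin_head_subst[OF lin_fetch.hyps(2)] in blast)
  then show ?case by simp
next
  case (fail B Ns xs Y M x)
  from fail.prems have "typed \<Gamma> (ESub M xs x B) \<tau>" by simp
  then obtain \<Gamma>' \<Delta> \<rho> \<sigma> where *: "\<Gamma> = \<Gamma>' ++ \<Delta>" "typed_bag \<Delta> B \<sigma>"
    "typed (sctx \<Gamma>' xs \<rho>) M \<tau>" "set xs \<inter> dom \<Gamma>' = {}"
    by (elim typed_ESub_ShareE) iprover
  \<comment> \<open>A failure term takes any type, so only the domain must be matched with its
    names.\<close>
  have "dom \<Gamma>' \<union> set xs = fv M" "dom \<Delta> = fv_bag B"
    using typed_dom[OF *(3)] typed_bag_dom[OF *(2)] by auto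
  then have "dom \<Gamma> = fset Y" using *(1,4) fail.hyps(3) by auto
  then show ?case by (auto simp: PER_nonempty intro: typed_Fail)
next
  case (cons1 B Ns Y X)
  from cons1.prems obtain \<Gamma>' \<Delta> \<sigma> where *: "\<Gamma> = \<Gamma>' ++ \<Delta>" "dom \<Gamma>' = fset X" "typed_bag \<Delta> B \<sigma>"
    by (auto elim!: typed_AppE typed_FailE)
  then have "dom \<Gamma> = fset (X |\<union>| Y)"
    using typed_bag_dom[OF *(3)] cons1.hyps(2) by auto
  then show ?case by (auto simp: PER_nonempty intro: typed_Fail)
next
  case (cons2 B Ns xs Y Z x)
  let ?M = "Fail (fset_of_list xs |\<union>| Y)"
  from cons2.prems have "typed \<Gamma> (ESub ?M xs x B) \<tau>" by simp
  then obtain \<Gamma>' \<Delta> \<rho> \<sigma> where *: "\<Gamma> = \<Gamma>' ++ \<Delta>" "typed_bag \<Delta> B \<sigma>"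
    "typed (sctx \<Gamma>' xs \<rho>) ?M \<tau>" "set xs \<inter> dom \<Gamma>' = {}"
    by (elim typed_ESub_ShareE) iprover
  have "dom \<Gamma>' \<union> set xs = fv ?M" "dom \<Delta> = fv_bag B"
    using typed_dom[OF *(3)] typed_bag_dom[OF *(2)] by auto
  \<comment> \<open>Disjointness on the left-hand side lets the shared names be cancelled, which
    leaves \<open>Y\<close>.\<close>
  moreover have "set xs \<inter> fset Y = {}"
    using cons2.hyps(3) by (metis bot_fset.rep_eq fset_of_list.rep_eq inf_fset.rep_eq)
  ultimately have "dom \<Gamma>' = fset Y"
    using *(4) by (simp add: fset_of_list.rep_eq) blast
  moreover have "dom \<Delta> = fset Z"
    using cons2.hyps(4) \<open>dom \<Delta> = fv_bag B\<close> by simp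
  ultimately have "dom \<Gamma> = fset (Y |\<union>| Z)" using *(1) by auto
  then show ?case by (auto simp: PER_nonempty intro: typed_Fail)
next
  case (cons3 x Y Z N)
  from cons3.prems have "typed \<Gamma> (LSub (Fail (finsert x Y)) N x) \<tau>" by simp
  then obtain \<Gamma>' \<Delta> \<sigma> where *: "\<Gamma> = \<Gamma>' ++ \<Delta>" "x \<notin> dom \<Gamma>'"
    "typed (\<Gamma>'(x \<mapsto> {#\<sigma>#})) (Fail (finsert x Y)) \<tau>" "typed \<Delta> N \<sigma>"
    by (elim typed_LSubE) iprover
  \<comment> \<open>Neither set contains \<open>x\<close>, so the two insertions cancel.\<close>
  have "insert x (dom \<Gamma>') = insert x (fset Y)" "dom \<Delta> = fset Z"
    using typed_dom[OF *(3)] typed_dom[OF *(4)] cons3.hyps(2) by auto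
  then have "dom \<Gamma> = fset (Y |\<union>| Z)"
    using *(1,2) cons3.hyps(1) by (metis Un_commute dom_map_add insert_ident sup_fset.rep_eq)
  then show ?case by (auto intro: typed_Fail)
next
  case (tcont M E C)
  from tcont.prems have "typed \<Gamma> (fill C M) \<tau>" by simp
  then obtain \<Gamma>' \<tau>' where
    M: "typed \<Gamma>' M \<tau>'" and fill: "\<forall>M'. typed \<Gamma>' M' \<tau>' \<longrightarrow> typed \<Gamma> (fill C M') \<tau>"
    by (rule typed_fillE)
  have "typed_expr \<Gamma>' E \<tau>'" using M by (intro tcont.IH) simp
  then show ?case using fill by simp
next
  case (econt E E' F)
  have "typed_expr \<Gamma> E' \<tau>"
    using econt.prems red_nonempty[OF econt.hyps] by (intro econt.IH) simp
  then show ?case using econt.prems by auto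
next
  case (red_alpha E F F' E')
  have "typed_expr \<Gamma> F \<tau>"
    using typed_expr_rel_alpha[OF red_alpha.hyps(1)] red_alpha.prems by (rule iffD1)
  then have "typed_expr \<Gamma> F' \<tau>" by (rule red_alpha.IH)
  with typed_expr_rel_alpha[OF red_alpha.hyps(3)] show ?case by (rule iffD1)
qed

theorem theorem3p17:
  fixes \<Gamma> :: "'v::infinite ctx" and E E' :: "'v expr" and \<tau> :: sty
  assumes "\<Gamma> \<Turnstile> E \<Colon> \<tau>"
    and "E \<longlongrightarrow>\<^sub>R E'"
  shows "\<Gamma> \<Turnstile> E' \<Colon> \<tau>"
  using red_typed[OF assms(2)] assms(1) unfolding wf_iff_typed .

end
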